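(* Let $R$ be an analytically irreducible Noetherian local ring of dimension $d$, and let $\mathcal I(1)=\{I(1)_i\},\ldots,\mathcal I(r)=\{I(r)_i\}$ be (not necessarily Noetherian) filtrations of $R$ by $m_R$-primary ideals. For $a\in\mathbb Z_+$ let $$F_a(x_1,\ldots,x_r)=\sum_{i_1+\cdots+i_r=d}b_{i_1,\ldots,i_r}(a)\,x_1^{i_1}\cdots x_r^{i_r}\in\mathbb Q[x_1,\ldots,x_r]$$ be the homogeneous polynomial of total degree $d$ such that $$F_a(n_1,\ldots,n_r)=\lim_{m\to\infty}\frac{\lambda(R/I_a(1)_{mn_1}\cdots I_a(r)_{mn_r})}{m^d}\quad\text{for all } n_1,\ldots,n_r\in\mathbb Z_+,$$ where $\{I_a(j)_i\}$ is the $a$-th truncated filtration of $\mathcal I(j)$. Then for all $i_1,\ldots,i_r\in\mathbb N$ with $i_1+\cdots+i_r=d$, the limit $$b_{i_1,\ldots,i_r}:=\lim_{a\to\infty}b_{i_1,\ldots,i_r}(a)$$ exists in $\mathbb R$.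
   Context: $\mathbb N$ = nonnegative integers, $\mathbb Z_+$ = positive integers, $\lambda$ = length as an $R$-module, $m_R$ = maximal ideal of $R$. $R$ is analytically irreducible if its $m_R$-adic completion is a domain. A filtration $\mathcal I=\{I_n\}_{n\in\mathbb N}$ of ideals on $R$ is a descending chain $R=I_0\supset I_1\supset I_2\supset\cdots$ of ideals with $I_iI_j\subset I_{i+j}$ for all $i,j$. It is a filtration by $m_R$-primary ideals if $I_j$ is $m_R$-primary for all $j\ge1$; it is Noetherian if $\bigoplus_{n\ge0}I_n$ is a finitely generated $R$-algebra. For $a\in\mathbb Z_+$, the $a$-th truncated filtration $\mathcal I_a=\{I_{a,n}\}$ of $\mathcal I=\{I_n\}$ is defined by $I_{a,n}=I_n$ if $n\le a$, and, for $n>a$, $I_{a,n}=\sum I_{a,i}I_{a,j}$, the sum over $i,j>0$ with $i+j=n$. (For $\mathcal I(j)$ its terms are written $I_a(j)_i$; it is a Noetherian filtration.) The polynomials $F_a$ exist because the truncated filtrations are Noetherian. *)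

theory Defs
  imports
    "HOL-Algebra.Algebra"
    "HOL-Library.Extended_Real"
begin

definition local_ring :: "('a, 'c) ring_scheme \<Rightarrow> bool"
  where "local_ring R \<longleftrightarrow> cring R \<and> (\<exists>!M. maximalideal M R)"

definition max_ideal :: "('a, 'c) ring_scheme \<Rightarrow> 'a set"
  where "max_ideal R = (THE M. maximalideal M R)"

definition krull_dim :: "('a, 'c) ring_scheme \<Rightarrow> enat"
  where "krull_dim R =
    Sup {enat n | n. \<exists>P. (\<forall>k\<le>n. primeideal (P k) R) \<and> (\<forall>k<n. P k \<subset> P (Suc k))}"

text \<open>
  The inverse limit of the rings \<open>R / I\<^sup>n\<close>.  The powers of \<open>I\<close> are taken in the monoid
  \<^term>\<open>ideals_set R\<close> of ideals of \<open>R\<close>.  Under \<open>R / I\<^bsup>n+1\<^esup> \<rightarrow> R / I\<^sup>n\<close> the coset of \<open>x\<close>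
  goes to the coset of \<open>x\<close>, so two consecutive components of a compatible sequence have a
  common representative.
\<close>

definition adic_completion :: "('a, 'c) ring_scheme \<Rightarrow> 'a set \<Rightarrow> (nat \<Rightarrow> 'a set) ring"
  where "adic_completion R I =
    (let Q = (\<lambda>n::nat. R Quot (I [^]\<^bsub>ideals_set R\<^esub> n)) in
     \<lparr> carrier = {f. \<forall>n. \<exists>x\<in>carrier R. f n = (I [^]\<^bsub>ideals_set R\<^esub> n) +>\<^bsub>R\<^esub> x \<and>
                                f (Suc n) = (I [^]\<^bsub>ideals_set R\<^esub> (Suc n)) +>\<^bsub>R\<^esub> x},
       monoid.mult = (\<lambda>f g n. f n \<otimes>\<^bsub>Q n\<^esub> g n),
       monoid.one = (\<lambda>n. \<one>\<^bsub>Q n\<^esub>),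
       ring.zero = (\<lambda>n. \<zero>\<^bsub>Q n\<^esub>),
       ring.add = (\<lambda>f g n. f n \<oplus>\<^bsub>Q n\<^esub> g n) \<rparr>)"

definition analytically_irreducible :: "('a, 'c) ring_scheme \<Rightarrow> bool"
  where "analytically_irreducible R \<longleftrightarrow> domain (adic_completion R (max_ideal R))"

definition module_length :: "('a, 'c) ring_scheme \<Rightarrow> ('a, 'b, 'e) module_scheme \<Rightarrow> enat"
  where "module_length R M =
    Sup {enat n | n. \<exists>N. (\<forall>k\<le>n. submodule (N k) R M) \<and> (\<forall>k<n. N k \<subset> N (Suc k))}"

text \<open>\<open>R\<close> acts on \<open>R / I\<close> through the projection \<open>R \<rightarrow> R / I\<close>.\<close>

definition quot_module :: "('a, 'c) ring_scheme \<Rightarrow> 'a set \<Rightarrow> ('a, 'a set) module"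
  where "quot_module R I =
    \<lparr> carrier = carrier (R Quot I),
      monoid.mult = monoid.mult (R Quot I),
      monoid.one = monoid.one (R Quot I),
      ring.zero = ring.zero (R Quot I),
      ring.add = ring.add (R Quot I),
      smult = (\<lambda>a C. (I +>\<^bsub>R\<^esub> a) \<otimes>\<^bsub>R Quot I\<^esub> C) \<rparr>"

definition radical :: "('a, 'c) ring_scheme \<Rightarrow> 'a set \<Rightarrow> 'a set"
  where "radical R I = {x \<in> carrier R. \<exists>n::nat. n > 0 \<and> x [^]\<^bsub>R\<^esub> n \<in> I}"

definition primary_ideal :: "('a, 'c) ring_scheme \<Rightarrow> 'a set \<Rightarrow> bool"
  where "primary_ideal R Q \<longleftrightarrow> ideal Q R \<and> Q \<noteq> carrier R \<and>
    (\<forall>x\<in>carrier R. \<forall>y\<in>carrier R. x \<otimes>\<^bsub>R\<^esub> y \<in> Q \<longrightarrow> x \<in> Q \<or> y \<in> radical R Q)"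

definition ideal_filtration :: "('a, 'c) ring_scheme \<Rightarrow> (nat \<Rightarrow> 'a set) \<Rightarrow> bool"
  where "ideal_filtration R I \<longleftrightarrow>
    (\<forall>n. ideal (I n) R) \<and> I 0 = carrier R \<and> (\<forall>n. I (Suc n) \<subseteq> I n) \<and>
    (\<forall>m n. I m \<cdot>\<^bsub>R\<^esub> I n \<subseteq> I (m + n))"

definition max_primary_filtration :: "('a, 'c) ring_scheme \<Rightarrow> (nat \<Rightarrow> 'a set) \<Rightarrow> bool"
  where "max_primary_filtration R I \<longleftrightarrow> ideal_filtration R I \<and>
    (\<forall>n\<ge>1. primary_ideal R (I n) \<and> radical R (I n) = max_ideal R)"

text \<open>
  The \<open>n\<close>-th term of the \<open>a\<close>-th truncated filtration, for \<open>a \<ge> 1\<close>.  For \<open>n > a\<close> it is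
  the sum of the ideals \<open>truncated R a I i \<cdot>\<^bsub>R\<^esub> truncated R a I (n - i)\<close> with \<open>0 < i < n\<close>,
  the sum of two ideals being their setwise sum.
\<close>

function truncated :: "('a, 'c) ring_scheme \<Rightarrow> nat \<Rightarrow> (nat \<Rightarrow> 'a set) \<Rightarrow> nat \<Rightarrow> 'a set"
  where "truncated R a I n =
    (if n \<le> a then I n
     else foldr (set_add R)
            (map (\<lambda>i. truncated R a I i \<cdot>\<^bsub>R\<^esub> truncated R a I (n - i)) [1..<n]) {\<zero>\<^bsub>R\<^esub>})"
  by pat_completeness auto
termination
  by (relation "Wellfounded.measure (\<lambda>(R, a, I, n). n)") auto

declare truncated.simps [simp del]

text \<open>Exponent vectors \<open>(i\<^sub>1, \<dots>, i\<^sub>r)\<close> are encoded as extensional functions on \<open>{1..r}\<close>.\<close>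

definition multi_indices :: "nat \<Rightarrow> nat \<Rightarrow> (nat \<Rightarrow> nat) set"
  where "multi_indices r d = {i \<in> {1..r} \<rightarrow>\<^sub>E UNIV. (\<Sum>j=1..r. i j) = d}"

lemma finite_multi_indices: "finite (multi_indices r d)"
proof (rule finite_subset)
  show "multi_indices r d \<subseteq> {1..r} \<rightarrow>\<^sub>E {..d}"
  proof
    fix i assume i: "i \<in> multi_indices r d"
    have "i j \<le> d" if "j \<in> {1..r}" for j
      using i member_le_sum[of j "{1..r}" i] that by (auto simp: multi_indices_def)
    with i show "i \<in> {1..r} \<rightarrow>\<^sub>E {..d}"
      by (auto simp: multi_indices_def PiE_iff)
  qed
  show "finite ({1..r} \<rightarrow>\<^sub>E {..d})"
    by (intro finite_PiE) auto
qed

text \<open>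
  The value at \<open>(x\<^sub>1, \<dots>, x\<^sub>r)\<close> of the homogeneous polynomial of degree \<open>d\<close> in \<open>r\<close> variables
  with coefficient family \<open>c\<close>.
\<close>

definition hom_poly_eval ::
    "nat \<Rightarrow> nat \<Rightarrow> ((nat \<Rightarrow> nat) \<Rightarrow> 'k) \<Rightarrow> (nat \<Rightarrow> 'k) \<Rightarrow> 'k::comm_semiring_1"
  where "hom_poly_eval r d c x = (\<Sum>i\<in>multi_indices r d. c i * (\<Prod>j=1..r. x j ^ i j))"

end

theory Submission
  imports Defs
begin

text \<open>
  Enlarging \<open>a\<close> enlarges the ideals of the truncated filtrations and hence their products, so the
  lengths of the quotients decrease. Thus \<open>F\<^sub>a(n)\<close> is, for every fixed \<open>n\<close>, a decreasing sequence of
  nonnegative reals in \<open>a\<close> and converges. The coefficients of a homogeneous polynomial are linear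
  combinations of finitely many of its values at positive integer points, so they converge as well.
\<close>

section \<open>Truncated filtrations and their growth with the truncation level\<close>

lemma set_add_mono: "A \<subseteq> A' \<Longrightarrow> B \<subseteq> B' \<Longrightarrow> A <+>\<^bsub>R\<^esub> B \<subseteq> A' <+>\<^bsub>R\<^esub> B'"
  unfolding set_add_def' by blast

lemma ideal_prod_mono:
  assumes "A \<subseteq> A'" "B \<subseteq> B'"
  shows "A \<cdot>\<^bsub>R\<^esub> B \<subseteq> A' \<cdot>\<^bsub>R\<^esub> B'"
proof
  fix x assume "x \<in> A \<cdot>\<^bsub>R\<^esub> B"
  then show "x \<in> A' \<cdot>\<^bsub>R\<^esub> B'"
    by induction (use assms in \<open>auto intro: ideal_prod.intros\<close>)
qed

lemma foldr_set_add_mono: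
  assumes "\<And>i. i \<in> set xs \<Longrightarrow> f i \<subseteq> g i"
  shows "foldr (set_add R) (map f xs) Z \<subseteq> foldr (set_add R) (map g xs) Z"
  using assms by (induction xs) (simp_all add: set_add_mono)

lemma (in ring) foldr_set_add_ideal:
  assumes "\<And>i. i \<in> set xs \<Longrightarrow> ideal (f i) R"
  shows "ideal (foldr (set_add R) (map f xs) {\<zero>}) R"
  using assms by (induction xs) (simp_all add: add_ideals zeroideal)

lemma (in ideal) foldr_set_add_subset:
  assumes "\<And>i. i \<in> set xs \<Longrightarrow> f i \<subseteq> I"
  shows "foldr (set_add R) (map f xs) {\<zero>} \<subseteq> I"
  using assms
proof (induction xs)
  case (Cons x xs)
  then have "foldr (set_add R) (map f (x # xs)) {\<zero>} \<subseteq> I <+> I"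
    by (simp add: set_add_mono)
  also have "\<dots> \<subseteq> I"
    by (auto simp: set_add_def')
  finally show ?case .
qed simp

lemma (in ring) truncated_ideal:
  assumes "ideal_filtration R I"
  shows "ideal (truncated R a I n) R"
proof (induction n rule: less_induct)
  case (less n)
  then have "ideal (truncated R a I i \<cdot> truncated R a I (n - i)) R" if "i \<in> set [1..<n]" for i
    using that by (intro ideal_prod_is_ideal) auto
  then show ?case
    using assms unfolding truncated.simps[of R a I n]
    by (auto simp: ideal_filtration_def intro!: foldr_set_add_ideal)
qed

text \<open>Every product summed beyond the cutoff lies in \<open>I i \<cdot> I (n - i)\<close>,
  hence in \<open>I n\<close> by multiplicativity of the filtration. This is what compares two
  truncations at an index lying between their cutoffs.\<close>

lemma (in ring) truncated_subset:
  assumes I: "ideal_filtration R I"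
  shows "truncated R a I n \<subseteq> I n"
proof (induction n rule: less_induct)
  case (less n)
  have "truncated R a I i \<cdot> truncated R a I (n - i) \<subseteq> I n" if "i \<in> set [1..<n]" for i
  proof -
    have "truncated R a I i \<cdot> truncated R a I (n - i) \<subseteq> I i \<cdot> I (n - i)"
      using less that by (intro ideal_prod_mono) auto
    also have "\<dots> \<subseteq> I (i + (n - i))"
      using I unfolding ideal_filtration_def by blast
    finally show ?thesis
      using that by simp
  qed
  moreover have "ideal (I n) R"
    using I by (simp add: ideal_filtration_def)
  ultimately show ?case
    unfolding truncated.simps[of R a I n] by (simp, intro impI ideal.foldr_set_add_subset) auto
qed

lemma (in ring) truncated_mono:
  assumes I: "ideal_filtration R I" and "a \<le> a'"
  shows "truncated R a I n \<subseteq> truncated R a' I n"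
proof (induction n rule: less_induct)
  case (less n)
  show ?case
  proof (cases "n \<le> a'")
    \<comment> \<open>Here the larger truncation still has the original term \<open>I n\<close>,
      which contains every truncation at \<open>n\<close>.\<close>
    case True
    then show ?thesis
      using truncated_subset[OF I] by (simp add: truncated.simps[of R a' I n])
  next
    \<comment> \<open>Now \<open>n\<close> is beyond both cutoffs, so both sides are sums over the
      same indices and compare summand by summand.\<close>
    case False
    have "truncated R a I i \<cdot> truncated R a I (n - i) \<subseteq> truncated R a' I i \<cdot> truncated R a' I (n - i)"
      if "i \<in> set [1..<n]" for i
      using less that by (intro ideal_prod_mono) auto
    then show ?thesis
      using False \<open>a \<le> a'\<close> unfolding truncated.simps[of R _ I n]
      by (simp, intro foldr_set_add_mono) simp
  qed
qed

section \<open>Finite products of ideals\<close>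

lemma (in cring) ideals_finprod_ideal:
  assumes "\<And>j. j \<in> A \<Longrightarrow> ideal (f j) R"
  shows "ideal (\<Otimes>\<^bsub>ideals_set R\<^esub> j\<in>A. f j) R"
  using comm_monoid.finprod_closed[OF ideals_set_is_comm_monoid, of f A] assms
  by (auto simp: ideals_set_def)

lemma (in cring) ideals_finprod_mono:
  assumes "\<And>j. j \<in> A \<Longrightarrow> ideal (f j) R" "\<And>j. j \<in> A \<Longrightarrow> ideal (g j) R"
    and "\<And>j. j \<in> A \<Longrightarrow> f j \<subseteq> g j"
  shows "(\<Otimes>\<^bsub>ideals_set R\<^esub> j\<in>A. f j) \<subseteq> (\<Otimes>\<^bsub>ideals_set R\<^esub> j\<in>A. g j)"
proof -
  interpret ISet: comm_monoid "ideals_set R"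
    by (rule ideals_set_is_comm_monoid)
  have mult: "A \<otimes>\<^bsub>ideals_set R\<^esub> B = A \<cdot> B" for A B
    by (simp add: ideals_set_def)
  show ?thesis
    using assms
  proof (induction A rule: infinite_finite_induct)
    case (insert x A)
    then have "f \<in> A \<rightarrow> carrier (ideals_set R)" "f x \<in> carrier (ideals_set R)"
      "g \<in> A \<rightarrow> carrier (ideals_set R)" "g x \<in> carrier (ideals_set R)"
      by (auto simp: ideals_set_def)
    with insert show ?case
      by (simp add: mult ideal_prod_mono)
  \<comment> \<open>For an empty or infinite index set both products are the unit of the
    monoid.\<close>
  qed auto
qed

section \<open>Length of quotients of the ring\<close>

text \<open>This and the next lemma carry submodules of one quotient of \<open>R\<close> to another:
  pull back to an ideal of \<open>R\<close>, then project.\<close>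

lemma (in ideal) submodule_quot_module_preimage:
  assumes "cring R" and N: "submodule N R (quot_module R I)"
  shows "ideal {x \<in> carrier R. I +> x \<in> N} R"
proof -
  interpret cring R by fact
  interpret hom: ring_hom_ring R "R Quot I" "(+>) I"
    by (rule rcos_ring_hom_ring)
  \<comment> \<open>\<open>quot_module\<close> copies the additive structure of
    \<open>R Quot I\<close>, so unfolding the records identifies the two notions of
    subgroup.\<close>
  have sub: "subgroup N (add_monoid (R Quot I))"
    using submodule.axioms(1)[OF N] by (simp add: quot_module_def subgroup_def m_inv_def)
  have a_inv: "\<ominus>\<^bsub>R Quot I\<^esub> C \<in> N" if "C \<in> N" for C
    using subgroup.m_inv_closed[OF sub that] by (simp add: a_inv_def m_inv_def)
  have smult: "I +> (a \<otimes> x) \<in> N" if "a \<in> carrier R" "x \<in> carrier R" "I +> x \<in> N" for a x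
    using submodule.smult_closed[OF N that(1,3)] that by (simp add: quot_module_def)
  show ?thesis
  proof (rule idealI)
    show "subgroup {x \<in> carrier R. I +> x \<in> N} (add_monoid R)"
    proof (rule add.subgroupI, goal_cases)
      case 2
      show ?case
        using subgroup.one_closed[OF sub] hom.hom_zero by force
    next
      case (3 x)
      then show ?case
        using a_inv[of "I +> x"] by (simp flip: a_inv_def)
    next
      case (4 x y)
      then show ?case
        using subgroup.m_closed[OF sub, of "I +> x" "I +> y"] by simp
    qed auto
    fix x a assume x: "x \<in> {x \<in> carrier R. I +> x \<in> N}" and a: "a \<in> carrier R"
    then show "a \<otimes> x \<in> {x \<in> carrier R. I +> x \<in> N}"
      using smult[of a x] by simp
    with x a show "x \<otimes> a \<in> {x \<in> carrier R. I +> x \<in> N}"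
      using m_comm[of a x] by auto
  qed (rule ring_axioms)
qed

lemma (in ideal) submodule_quot_module_image:
  assumes "cring R" and K: "ideal K R"
  shows "submodule ((+>) I ` K) R (quot_module R I)"
proof -
  interpret cring R by fact
  interpret K: ideal K R by fact
  interpret hom: ring_hom_ring R "R Quot I" "(+>) I"
    by (rule rcos_ring_hom_ring)
  have "subgroup ((+>) I ` K) (add_monoid (R Quot I))"
    using K.a_subgroup by (rule group_hom.subgroup_img_is_subgroup[OF hom.a_group_hom])
  moreover have "a \<odot>\<^bsub>quot_module R I\<^esub> C \<in> (+>) I ` K"
    if "a \<in> carrier R" "C \<in> (+>) I ` K" for a C
    using that K.I_l_closed
    by (auto simp: quot_module_def simp flip: hom.hom_mult)
  ultimately show ?thesis
    by (simp add: submodule_def submodule_axioms_def quot_module_def subgroup_def m_inv_def)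
qed

text \<open>A strict chain of submodules of \<open>R / J\<close> gives one with as many steps in
  \<open>R / I\<close>: take preimages in \<open>R\<close> and project them to
  \<open>R / I\<close>.\<close>

lemma (in cring) module_length_quot_antimono:
  assumes "ideal I R" "ideal J R" "I \<subseteq> J"
  shows "module_length R (quot_module R J) \<le> module_length R (quot_module R I)"
proof -
  interpret I: ideal I R by fact
  interpret J: ideal J R by fact
  have "\<exists>N'. (\<forall>k\<le>n. submodule (N' k) R (quot_module R I)) \<and> (\<forall>k<n. N' k \<subset> N' (Suc k))"
    if N: "\<forall>k\<le>n. submodule (N k) R (quot_module R J)" and chain: "\<forall>k<n. N k \<subset> N (Suc k)"
    for n N
  proof (intro exI conjI allI impI)
    define N' where "N' = (\<lambda>k. (+>) I ` {x \<in> carrier R. J +> x \<in> N k})"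
    show "submodule (N' k) R (quot_module R I)" if "k \<le> n" for k
      unfolding N'_def
      using N that is_cring
      by (intro I.submodule_quot_module_image J.submodule_quot_module_preimage) auto
    show "N' k \<subset> N' (Suc k)" if k: "k < n" for k
    proof (rule psubsetI)
      show "N' k \<subseteq> N' (Suc k)"
        using chain k unfolding N'_def by blast
      obtain C where C: "C \<in> N (Suc k)" "C \<notin> N k"
        using chain k by blast
      have "submodule (N (Suc k)) R (quot_module R J)"
        using N k by simp
      then have "N (Suc k) \<subseteq> carrier (R Quot J)"
        using subgroup.subset[OF submodule.axioms(1)] by (fastforce simp: quot_module_def)
      with C obtain x where x: "x \<in> carrier R" "C = J +> x"
        by (auto simp: FactRing_def A_RCOSETS_def')
      \<comment> \<open>Since \<open>I \<subseteq> J\<close>, an \<open>I\<close>-coset determines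
        the \<open>J\<close>-coset containing it. This keeps the new chain strict: the class of
        \<open>x\<close> modulo \<open>I\<close> is in \<open>N' (Suc k)\<close> but cannot come
        from \<open>N k\<close>.\<close>
      have coset_eq: "J +> x = J +> y" if "y \<in> carrier R" "I +> x = I +> y" for y
      proof (rule J.a_repr_independence'[symmetric])
        have "x \<in> I +> y"
          using I.a_rcos_self[OF x(1)] that(2) by simp
        with \<open>I \<subseteq> J\<close> show "x \<in> J +> y"
          by (auto simp: a_r_coset_def')
      qed (rule that(1))
      have "I +> x \<notin> N' k"
      proof
        assume "I +> x \<in> N' k"
        then obtain y where "y \<in> carrier R" "I +> x = I +> y" "J +> y \<in> N k"
          unfolding N'_def by blast
        with C x coset_eq[of y] show False
          by simp
      qed
      moreover have "I +> x \<in> N' (Suc k)"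
        using C x unfolding N'_def by blast
      ultimately show "N' k \<noteq> N' (Suc k)"
        by blast
    qed
  qed
  then show ?thesis
    unfolding module_length_def by (intro Sup_subset_mono) blast
qed

section \<open>Recovering coefficients from values at positive integer points\<close>

text \<open>
  Replacing \<open>p(x)\<close> by \<open>p(\<dots>, 2 x\<^sub>j, \<dots>) - 2\<^sup>e p(x)\<close> removes the monomials of degree \<open>e\<close> in \<open>x\<^sub>j\<close> and
  multiplies the other coefficients by nonzero constants.
\<close>

lemma convergent_coefficients:
  fixes c :: "nat \<Rightarrow> ('i \<Rightarrow> nat) \<Rightarrow> real"
  assumes "finite A" "finite S" "S \<subseteq> extensional A"
    and "\<And>n :: 'i \<Rightarrow> nat. (\<And>j. n j \<ge> 1) \<Longrightarrow>
      convergent (\<lambda>a. \<Sum>i\<in>S. c a i * (\<Prod>j\<in>A. real (n j) ^ i j))"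
    and "i \<in> S"
  shows "convergent (\<lambda>a. c a i)"
  using assms(2-)
proof (induction S arbitrary: c i rule: finite_induct)
  case (insert s S)
  note conv = insert.prems(2)
  have other: "convergent (\<lambda>a. c a i)" if i: "i \<in> S" for i
  proof -
    have "i \<noteq> s" "i \<in> extensional A" "s \<in> extensional A"
      using i insert by auto
    \<comment> \<open>Both exponent vectors are extensional, so they already differ at a coordinate
      inside \<open>A\<close>.\<close>
    then obtain k where k: "k \<in> A" "i k \<noteq> s k"
      by (meson extensionalityI)
    \<comment> \<open>These are the coefficients after doubling the \<open>k\<close>-th variable and
      subtracting \<open>2 ^ s k\<close> times the original; the one at \<open>s\<close> vanishes,
      the one at \<open>i\<close> is a nonzero multiple of \<open>c a i\<close>.\<close>
    define c' :: "nat \<Rightarrow> ('i \<Rightarrow> nat) \<Rightarrow> real" where "c' = (\<lambda>a i. c a i * (2 ^ i k - 2 ^ s k))"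
    have "convergent (\<lambda>a. c' a i)"
    proof (rule insert.IH)
      fix n :: "'i \<Rightarrow> nat" assume n: "\<And>j. n j \<ge> 1"
      define m where "m = n(k := 2 * n k)"
      have m: "m j \<ge> 1" for j
        using n by (simp add: m_def)
      have scale: "(\<Prod>j\<in>A. real (m j) ^ t j) = 2 ^ t k * (\<Prod>j\<in>A. real (n j) ^ t j)" for t
      proof -
        have "(\<Prod>j\<in>A - {k}. real (m j) ^ t j) = (\<Prod>j\<in>A - {k}. real (n j) ^ t j)"
          by (rule prod.cong) (auto simp: m_def)
        then show ?thesis
          using \<open>finite A\<close> k by (simp add: prod.remove[of A k] m_def power_mult_distrib)
      qed
      \<comment> \<open>The term at \<open>s\<close> may be added because \<open>c' a s = 0\<close>;
        the sum then becomes a combination of the values at \<open>m\<close> and \<open>n\<close>,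
        both covered by the hypothesis.\<close>
      have "(\<Sum>t\<in>S. c' a t * (\<Prod>j\<in>A. real (n j) ^ t j)) =
          (\<Sum>t\<in>insert s S. c' a t * (\<Prod>j\<in>A. real (n j) ^ t j))" for a
        using insert.hyps by (simp add: c'_def)
      also have "\<dots> a = (\<Sum>t\<in>insert s S. c a t * (\<Prod>j\<in>A. real (m j) ^ t j)) -
          2 ^ s k * (\<Sum>t\<in>insert s S. c a t * (\<Prod>j\<in>A. real (n j) ^ t j))" for a
        unfolding scale c'_def sum_distrib_left sum_subtractf[symmetric]
        by (rule sum.cong) (auto simp: algebra_simps)
      finally show "convergent (\<lambda>a. \<Sum>t\<in>S. c' a t * (\<Prod>j\<in>A. real (n j) ^ t j))"
        using conv[OF m] conv[OF n]
        by (simp add: convergent_diff convergent_mult convergent_const)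
    qed (use i insert in auto)
    then show ?thesis
      using k by (simp add: c'_def convergent_mult_const_right_iff)
  qed
  \<comment> \<open>The value at the all-ones point is the sum of all coefficients, so the last one
    follows from the others.\<close>
  have "c a s = (\<Sum>t\<in>insert s S. c a t) - (\<Sum>t\<in>S. c a t)" for a
    using insert.hyps by simp
  moreover have "convergent (\<lambda>a. (\<Sum>t\<in>insert s S. c a t) - (\<Sum>t\<in>S. c a t))"
    using conv[of "\<lambda>_. 1"] convergent_sum[of S "\<lambda>t a. c a t"] other
    by (intro convergent_diff) auto
  ultimately have "convergent (\<lambda>a. c a s)"
    by presburger
  with other insert.prems show ?case
    by auto
qed simp

section \<open>Passage to the limit in the truncation level\<close>

theorem corollary4p4:
  fixes R :: "('a, 'c) ring_scheme"
    and d r :: nat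
    and I :: "nat \<Rightarrow> nat \<Rightarrow> 'a set"
    and b :: "nat \<Rightarrow> (nat \<Rightarrow> nat) \<Rightarrow> rat"
  assumes "noetherian_ring R"
    and "local_ring R"
    and "analytically_irreducible R"
    and "krull_dim R = enat d"
    and "r \<ge> 1"
    and "\<And>j. j \<in> {1..r} \<Longrightarrow> max_primary_filtration R (I j)"
    and F: "\<And>a n. a \<ge> 1 \<Longrightarrow> (\<And>j. j \<in> {1..r} \<Longrightarrow> n j \<ge> 1) \<Longrightarrow>
      (\<lambda>m. ereal_of_enat (module_length R (quot_module R
              (\<Otimes>\<^bsub>ideals_set R\<^esub> j\<in>{1..r}. truncated R a (I j) (m * n j)))) / ereal (real m ^ d))
        \<longlonglongrightarrow> ereal (real_of_rat (hom_poly_eval r d (b a) (\<lambda>j. of_nat (n j))))"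
  shows "\<forall>i\<in>multi_indices r d. convergent (\<lambda>a. real_of_rat (b a i))"
proof
  fix i assume i: "i \<in> multi_indices r d"
  interpret cring R
    using \<open>local_ring R\<close> by (simp add: local_ring_def)
  have filt: "ideal_filtration R (I j)" if "j \<in> {1..r}" for j
    using assms(6)[OF that] by (simp add: max_primary_filtration_def)
  show "convergent (\<lambda>a. real_of_rat (b a i))"
  proof (rule convergent_coefficients[of "{1..r}" "multi_indices r d" "\<lambda>a i. real_of_rat (b a i)"])
    show "multi_indices r d \<subseteq> extensional {1..r}"
      by (auto simp: multi_indices_def PiE_def)
    fix n :: "nat \<Rightarrow> nat" assume n: "\<And>j. n j \<ge> 1"
    define q where "q = (\<lambda>a. real_of_rat (hom_poly_eval r d (b a) (\<lambda>j. of_nat (n j))))"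
    define P where "P = (\<lambda>a m. \<Otimes>\<^bsub>ideals_set R\<^esub> j\<in>{1..r}. truncated R a (I j) (m * n j))"
    define L where "L = (\<lambda>a m. ereal_of_enat (module_length R (quot_module R (P a m))) / ereal (real m ^ d))"
    have lim: "L a \<longlonglongrightarrow> ereal (q a)" if "a \<ge> 1" for a
      unfolding L_def P_def q_def using that n by (intro F) auto
    have "module_length R (quot_module R (P (Suc a) m)) \<le> module_length R (quot_module R (P a m))"
      for a m
      unfolding P_def
      by (intro module_length_quot_antimono ideals_finprod_ideal ideals_finprod_mono
          truncated_ideal truncated_mono filt) auto
    \<comment> \<open>The index \<open>m = 0\<close> is left out so that the denominator is
      positive; finitely many terms do not affect the limit.\<close>
    then have "L (Suc a) m \<le> L a m" if "m \<ge> 1" for a m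
      unfolding L_def using that by (intro ereal_divide_right_mono) auto
    then have "q (Suc a) \<le> q a" if "a \<ge> 1" for a
      using LIMSEQ_le[OF lim[of "Suc a"] lim[OF that]] by auto
    \<comment> \<open>The hypothesis on \<open>b a\<close> starts at \<open>a = 1\<close>, hence the
      shift by one, undone below by \<open>convergent_Suc_iff\<close>.\<close>
    then have "decseq (\<lambda>a. q (Suc a))"
      by (intro decseq_SucI) simp
    moreover have "0 \<le> L a m" if "m \<ge> 1" for a m
      using that unfolding L_def by (intro zero_le_divide_ereal) auto
    then have "0 \<le> q a" if "a \<ge> 1" for a
      using LIMSEQ_le_const[OF lim[OF that], of 0] by (auto simp: zero_ereal_def)
    then have "0 \<le> q (Suc a)" for a
      by simp
    ultimately have "convergent (\<lambda>a. q (Suc a))"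
      by (metis decseq_convergent convergentI)
    then have "convergent q"
      by (simp add: convergent_Suc_iff)
    then show "convergent (\<lambda>a. \<Sum>i\<in>multi_indices r d. real_of_rat (b a i) * (\<Prod>j\<in>{1..r}. real (n j) ^ i j))"
      by (simp add: q_def hom_poly_eval_def of_rat_sum of_rat_mult of_rat_prod of_rat_power)
  qed (use i finite_multi_indices in auto)
qed

end
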